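(* Let $\alpha\in\mathbb{R}\setminus\{0\}$ and let $M$ be a $K^{\alpha}$-translator with speed $w$. If $M$ is a canal surface, then the tangent vector of the spine (center) curve of $M$ is parallel to $w$.
   Context: A canal surface $M$ in $\mathbb{E}^3$ is a regular surface parametrized by $$X(s,\theta)=c(s)+r(s)\big(\sin\varphi\cos\theta\,N+\sin\varphi\sin\theta\,B+\cos\varphi\,T\big),\qquad s\in[0,\ell],\ \theta\in[0,2\pi),$$ where $c(s)$ (the spine or center curve) is a unit-speed curve of length $\ell$ with Frenet frame $\{T,N,B\}$ satisfying $T'=\kappa N$, $N'=-\kappa T+\tau B$, $B'=-\tau N$ (for a straight line, $\kappa=0$ and $\{T,N,B\}$ is a constant orthonormal frame with $T$ tangent to the line), $r(s)>0$ is the radial function, and $\varphi=\varphi(s)$ is a smooth function with $r'(s)=-\cos\varphi(s)$. Its unit normal is taken to be $U=\cos\varphi\,T+\sin\varphi\cos\theta\,N+\sin\varphi\sin\theta\,B$, and its Gauss curvature is $K=\frac{Q}{rP}$ with $P=rr''+r\kappa\sin\varphi\cos\theta-\sin^2\varphi$ and $Q=r''+\kappa\sin\varphi\cos\theta$. For a constant $\alpha\neq0$, a surface with Gauss curvature $K$ and unit normal $U$ is a $K^{\alpha}$-translator with speed $w$, where $w\in\mathbb{R}^3$ is a constant unit vector, if $K^{\alpha}=\langle U,w\rangle$ everywhere on the surface. The Gauss curvature of a translator is assumed nowhere zero, and $K^{\alpha}$ must be a well-defined real number: powers of negative numbers are used only for integer exponents. *)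

theory Defs
  imports "HOL-Analysis.Analysis"
begin

(* On a compact interval S the derivatives at the end points are one-sided. *)
definition smooth_within :: "real set \<Rightarrow> (real \<Rightarrow> 'a::real_normed_vector) \<Rightarrow> bool" where
  "smooth_within S f \<longleftrightarrow>
     (\<exists>D :: nat \<Rightarrow> real \<Rightarrow> 'a.
        (\<forall>s\<in>S. D 0 s = f s) \<and>
        (\<forall>n. \<forall>s\<in>S. (D n has_vector_derivative D (Suc n) s) (at s within S)))"

(* A parametrized surface is a map X :: real \<Rightarrow> real \<Rightarrow> real^3 of two parameters
   s \<in> S and \<theta>.  The second parameter is an angle, so X s is defined on all of the
   real line and the partial derivative in \<theta> is two-sided even at \<theta> = 0. *)

definition partial_s :: "real set \<Rightarrow> (real \<Rightarrow> real \<Rightarrow> real^3) \<Rightarrow> real \<Rightarrow> real \<Rightarrow> real^3" where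
  "partial_s S X s \<theta> = vector_derivative (\<lambda>u. X u \<theta>) (at s within S)"

definition partial_t :: "(real \<Rightarrow> real \<Rightarrow> real^3) \<Rightarrow> real \<Rightarrow> real \<Rightarrow> real^3" where
  "partial_t X s \<theta> = vector_derivative (\<lambda>t. X s t) (at \<theta>)"

definition regular_param ::
  "real set \<Rightarrow> real set \<Rightarrow> (real \<Rightarrow> real \<Rightarrow> real^3) \<Rightarrow> bool" where
  "regular_param S A X \<longleftrightarrow>
     (\<forall>s\<in>S. \<forall>\<theta>\<in>A. cross3 (partial_s S X s \<theta>) (partial_t X s \<theta>) \<noteq> 0)"

definition unit_normal ::
  "real set \<Rightarrow> real set \<Rightarrow> (real \<Rightarrow> real \<Rightarrow> real^3) \<Rightarrow> (real \<Rightarrow> real \<Rightarrow> real^3) \<Rightarrow> bool" where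
  "unit_normal S A X U \<longleftrightarrow>
     (\<forall>s\<in>S. \<forall>\<theta>\<in>A. norm (U s \<theta>) = 1 \<and>
        U s \<theta> \<bullet> partial_s S X s \<theta> = 0 \<and> U s \<theta> \<bullet> partial_t X s \<theta> = 0)"

(* Quotient of the determinants of the second and the first fundamental form. *)
definition gauss_curvature ::
  "real set \<Rightarrow> (real \<Rightarrow> real \<Rightarrow> real^3) \<Rightarrow> (real \<Rightarrow> real \<Rightarrow> real^3) \<Rightarrow> real \<Rightarrow> real \<Rightarrow> real" where
  "gauss_curvature S X U s \<theta> =
     (let Xs = partial_s S X s \<theta>;
          Xt = partial_t X s \<theta>;
          Xss = partial_s S (partial_s S X) s \<theta>;
          Xst = partial_t (partial_s S X) s \<theta>;
          Xtt = partial_t (partial_t X) s \<theta>;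
          n = U s \<theta>
      in ((Xss \<bullet> n) * (Xtt \<bullet> n) - (Xst \<bullet> n)\<^sup>2) / ((Xs \<bullet> Xs) * (Xt \<bullet> Xt) - (Xs \<bullet> Xt)\<^sup>2))"

(* For x > 0 both branches agree with x powr a.  The result is meaningful for x < 0
   only if a is an integer; for x \<noteq> 0 this is recorded in real_power_defined. *)
definition real_power :: "real \<Rightarrow> real \<Rightarrow> real" where
  "real_power x a = (if a \<in> \<int> then x powi \<lfloor>a\<rfloor> else x powr a)"

definition real_power_defined :: "real \<Rightarrow> real \<Rightarrow> bool" where
  "real_power_defined x a \<longleftrightarrow> x > 0 \<or> a \<in> \<int>"

definition K_translator ::
  "real \<Rightarrow> real^3 \<Rightarrow> real set \<Rightarrow> real set \<Rightarrow>
     (real \<Rightarrow> real \<Rightarrow> real^3) \<Rightarrow> (real \<Rightarrow> real \<Rightarrow> real^3) \<Rightarrow> bool" where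
  "K_translator \<alpha> w S A X U \<longleftrightarrow>
     norm w = 1 \<and> regular_param S A X \<and> unit_normal S A X U \<and>
     (\<forall>s\<in>S. \<forall>\<theta>\<in>A.
        gauss_curvature S X U s \<theta> \<noteq> 0 \<and>
        real_power_defined (gauss_curvature S X U s \<theta>) \<alpha> \<and>
        real_power (gauss_curvature S X U s \<theta>) \<alpha> = U s \<theta> \<bullet> w)"

(* Unit speed is expressed by c' = T and norm (T s) = 1.  The frame is given together
   with the curve because it is not determined by c where the curvature vanishes;
   for a straight line it is required to be constant. *)
definition frenet_curve ::
  "real \<Rightarrow> (real \<Rightarrow> real^3) \<Rightarrow> (real \<Rightarrow> real^3) \<Rightarrow> (real \<Rightarrow> real^3) \<Rightarrow> (real \<Rightarrow> real^3) \<Rightarrow>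
     (real \<Rightarrow> real) \<Rightarrow> (real \<Rightarrow> real) \<Rightarrow> bool" where
  "frenet_curve l c T N B \<kappa> \<tau> \<longleftrightarrow>
     smooth_within {0..l} c \<and> smooth_within {0..l} T \<and>
     smooth_within {0..l} N \<and> smooth_within {0..l} B \<and>
     smooth_within {0..l} \<kappa> \<and> smooth_within {0..l} \<tau> \<and>
     (\<forall>s\<in>{0..l}.
        (c has_vector_derivative T s) (at s within {0..l}) \<and>
        norm (T s) = 1 \<and> norm (N s) = 1 \<and> T s \<bullet> N s = 0 \<and> B s = cross3 (T s) (N s) \<and>
        (T has_vector_derivative \<kappa> s *\<^sub>R N s) (at s within {0..l}) \<and>
        (N has_vector_derivative - \<kappa> s *\<^sub>R T s + \<tau> s *\<^sub>R B s) (at s within {0..l}) \<and>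
        (B has_vector_derivative - \<tau> s *\<^sub>R N s) (at s within {0..l})) \<and>
     ((\<forall>s\<in>{0..l}. \<kappa> s = 0) \<longrightarrow> (\<forall>s\<in>{0..l}. N s = N 0 \<and> B s = B 0))"

definition canal_normal ::
  "(real \<Rightarrow> real^3) \<Rightarrow> (real \<Rightarrow> real^3) \<Rightarrow> (real \<Rightarrow> real^3) \<Rightarrow> (real \<Rightarrow> real) \<Rightarrow>
     real \<Rightarrow> real \<Rightarrow> real^3" where
  "canal_normal T N B \<phi> s \<theta> =
     cos (\<phi> s) *\<^sub>R T s + (sin (\<phi> s) * cos \<theta>) *\<^sub>R N s + (sin (\<phi> s) * sin \<theta>) *\<^sub>R B s"

definition canal_map ::
  "(real \<Rightarrow> real^3) \<Rightarrow> (real \<Rightarrow> real^3) \<Rightarrow> (real \<Rightarrow> real^3) \<Rightarrow> (real \<Rightarrow> real^3) \<Rightarrow>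
     (real \<Rightarrow> real) \<Rightarrow> (real \<Rightarrow> real) \<Rightarrow> real \<Rightarrow> real \<Rightarrow> real^3" where
  "canal_map c T N B r \<phi> s \<theta> =
     c s + r s *\<^sub>R ((sin (\<phi> s) * cos \<theta>) *\<^sub>R N s + (sin (\<phi> s) * sin \<theta>) *\<^sub>R B s
                    + cos (\<phi> s) *\<^sub>R T s)"

definition canal_surface ::
  "real \<Rightarrow> (real \<Rightarrow> real^3) \<Rightarrow> (real \<Rightarrow> real^3) \<Rightarrow> (real \<Rightarrow> real^3) \<Rightarrow> (real \<Rightarrow> real^3) \<Rightarrow>
     (real \<Rightarrow> real) \<Rightarrow> (real \<Rightarrow> real) \<Rightarrow> (real \<Rightarrow> real) \<Rightarrow> (real \<Rightarrow> real) \<Rightarrow> bool" where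
  "canal_surface l c T N B \<kappa> \<tau> r \<phi> \<longleftrightarrow>
     l > 0 \<and> frenet_curve l c T N B \<kappa> \<tau> \<and>
     smooth_within {0..l} r \<and> smooth_within {0..l} \<phi> \<and>
     (\<forall>s\<in>{0..l}. r s > 0 \<and> (r has_real_derivative - cos (\<phi> s)) (at s within {0..l})) \<and>
     regular_param {0..l} {0..<2 * pi} (canal_map c T N B r \<phi>)"

end

theory Submission
  imports Defs
begin

text \<open>
  The argument takes place on one characteristic circle \<open>s = const\<close>.  With \<open>q = \<phi>' + \<kappa> cos \<theta>\<close>
  the Gauss curvature of a canal surface is \<open>K = q / (r (r q - sin \<phi>))\<close>, so on the circle it
  depends on \<open>\<theta>\<close> through \<open>x = cos \<theta>\<close> only and is a Moebius function of \<open>x\<close>.  The right-hand side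
  of the translator equation is
  \<open>\<langle>U,w\<rangle> = cos \<phi> \<langle>T,w\<rangle> + sin \<phi> \<langle>N,w\<rangle> cos \<theta> + sin \<phi> \<langle>B,w\<rangle> sin \<theta>\<close>.
  Since \<open>K\<close> is the same at \<open>\<theta> = \<pi>/2\<close> and \<open>\<theta> = 3\<pi>/2\<close>, where \<open>sin \<theta>\<close> has opposite signs, and
  \<open>sin \<phi> \<noteq> 0\<close> by regularity, it follows that \<open>\<langle>B,w\<rangle> = 0\<close>.

  What remains is an identity \<open>K\<^sup>\<alpha> = A + C x\<close> on \<open>[-1,1]\<close> with \<open>C = sin \<phi> \<langle>N,w\<rangle>\<close>.  Its
  logarithmic derivative in \<open>x\<close>, cleared of denominators, is
  \<open>- \<alpha> \<kappa> sin \<phi> (A + C x) = C q (r q - sin \<phi>)\<close> with \<open>q = \<phi>' + \<kappa> x\<close>.  The left side is affine in \<open>x\<close>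
  and the right side has the quadratic term \<open>C r \<kappa>\<^sup>2 x\<^sup>2\<close>, so \<open>C = 0\<close> or \<open>\<kappa> = 0\<close>; in the latter
  case the left side vanishes, and again \<open>C = 0\<close> since \<open>q\<close> and \<open>r q - sin \<phi>\<close> do not vanish.  This is
  \<open>affine_power_of_moebius_constant\<close>.
  Hence \<open>w\<close> is orthogonal to \<open>N\<close> and \<open>B\<close>, that is, parallel to \<open>T\<close>.

  The formula for \<open>K\<close> is \<open>gauss_curvature_canal\<close>.  Differentiating \<open>\<langle>X\<^sub>s,U\<rangle> = \<langle>X\<^sub>\<theta>,U\<rangle> = 0\<close> turns the second fundamental form into
  inner products of first derivatives (\<open>gauss_curvature_weingarten\<close>), which the Frenet frame
  makes explicit.
\<close>

section \<open>Affine powers of Moebius functions\<close>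

text \<open>
  Passing to logarithms of squares removes the case distinction between positive bases and
  integer exponents: in both cases \<open>\<bar>x\<^sup>a\<bar> = \<bar>x\<bar>\<^sup>a\<close>.
\<close>
lemma ln_square_real_power:
  assumes "x \<noteq> 0" "real_power_defined x a"
  shows "real_power x a \<noteq> 0" "ln ((real_power x a)\<^sup>2) = a * ln (x\<^sup>2)"
proof -
  have ln_sq: "ln (y\<^sup>2) = 2 * ln \<bar>y\<bar>" if "y \<noteq> 0" for y :: real
    using that ln_realpow[of "\<bar>y\<bar>" 2] by simp
  have abs_eq: "\<bar>real_power x a\<bar> = \<bar>x\<bar> powr a"
  proof (cases "a \<in> \<int>")
    case True
    then obtain n :: int where "a = of_int n" by (auto elim: Ints_cases)
    then show ?thesis
      using assms(1) by (simp add: real_power_def power_int_abs powr_real_of_int')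
  next
    case False
    then show ?thesis using assms(2) by (simp add: real_power_def real_power_defined_def)
  qed
  then show nz: "real_power x a \<noteq> 0" using assms(1) by auto
  show "ln ((real_power x a)\<^sup>2) = a * ln (x\<^sup>2)"
    using assms(1) nz by (simp add: ln_sq abs_eq ln_powr)
qed

lemma DERIV_ln_square:
  assumes "(g has_real_derivative g') (at x)" "g x \<noteq> 0"
  shows "((\<lambda>x. ln ((g x)\<^sup>2)) has_real_derivative 2 * g' / g x) (at x)"
  using assms by (auto intro!: derivative_eq_intros) (simp add: power2_eq_square)

text \<open>
  A power of a Moebius function without zeros and poles on \<open>[-1,1]\<close> is not a nonconstant affine
  function there.  The logarithmic derivative
  of \<open>q / (r (r q - m))\<close> is \<open>- k m / (q (r q - m))\<close>, while that of \<open>A + C x\<close> is \<open>C / (A + C x)\<close>;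
  comparing the two gives an equation between an affine and a quadratic polynomial.
\<close>
lemma affine_power_of_moebius_constant:
  fixes r m d k A C \<alpha> :: real
  assumes r: "r \<noteq> 0"
    and nz: "\<And>x. x \<in> {-1..1} \<Longrightarrow> d + k * x \<noteq> 0"
            "\<And>x. x \<in> {-1..1} \<Longrightarrow> r * (d + k * x) - m \<noteq> 0"
    and def: "\<And>x. x \<in> {-1..1} \<Longrightarrow>
        real_power_defined ((d + k * x) / (r * (r * (d + k * x) - m))) \<alpha>"
    and eq: "\<And>x. x \<in> {-1..1} \<Longrightarrow>
        real_power ((d + k * x) / (r * (r * (d + k * x) - m))) \<alpha> = A + C * x"
  shows "C = 0"
proof -
  let ?q = "\<lambda>x. d + k * x"
  let ?f = "\<lambda>x. \<alpha> * (ln ((?q x)\<^sup>2) - ln ((r * (r * ?q x - m))\<^sup>2))"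
  let ?h = "\<lambda>x. ln ((A + C * x)\<^sup>2)"
  have affine_nz: "A + C * x \<noteq> 0" and fh: "?f x = ?h x" if x: "x \<in> {-1..1}" for x
  proof -
    let ?K = "?q x / (r * (r * ?q x - m))"
    have K: "?K \<noteq> 0" using nz[OF x] r by simp
    show "A + C * x \<noteq> 0" using ln_square_real_power(1)[OF K def[OF x]] eq[OF x] by simp
    have "ln (?K\<^sup>2) = ln ((?q x)\<^sup>2) - ln ((r * (r * ?q x - m))\<^sup>2)"
      unfolding power_divide using nz[OF x] r by (subst ln_div) auto
    then show "?f x = ?h x"
      using ln_square_real_power(2)[OF K def[OF x]] eq[OF x] by simp
  qed
  have poly: "- (\<alpha> * k * m) * (A + C * x) = C * ?q x * (r * ?q x - m)"
    if x: "x \<in> {-1<..<1}" for x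
  proof -
    have x': "x \<in> {-1..1}" using x by simp
    have "((\<lambda>x. ln ((?q x)\<^sup>2)) has_real_derivative 2 * k / ?q x) (at x)"
      by (rule DERIV_ln_square) (use nz[OF x'] in \<open>auto intro!: derivative_eq_intros\<close>)
    moreover have "((\<lambda>x. ln ((r * (r * ?q x - m))\<^sup>2)) has_real_derivative
        2 * (r * (r * k)) / (r * (r * ?q x - m))) (at x)"
      by (rule DERIV_ln_square) (use nz[OF x'] r in \<open>auto intro!: derivative_eq_intros\<close>)
    ultimately have df: "(?f has_real_derivative
        \<alpha> * (2 * k / ?q x - 2 * (r * (r * k)) / (r * (r * ?q x - m)))) (at x)"
      by (intro DERIV_cmult DERIV_diff)
    have dh: "(?h has_real_derivative 2 * C / (A + C * x)) (at x)"
      by (rule DERIV_ln_square) (use affine_nz[OF x'] in \<open>auto intro!: derivative_eq_intros\<close>)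
    have "(?f has_real_derivative 2 * C / (A + C * x)) (at x)"
      by (rule has_field_derivative_transform_within_open[OF dh, of "{-1<..<1}"])
        (use x fh in auto)
    then have "\<alpha> * (2 * k / ?q x - 2 * (r * (r * k)) / (r * (r * ?q x - m))) = 2 * C / (A + C * x)"
      using df DERIV_unique by blast
    moreover have "\<alpha> * (2 * k / ?q x - 2 * (r * (r * k)) / (r * (r * ?q x - m)))
        = 2 * (- (\<alpha> * k * m)) / (?q x * (r * ?q x - m))"
      using nz[OF x'] r by (simp add: divide_simps) (simp add: algebra_simps)
    ultimately have "2 * (- (\<alpha> * k * m)) / (?q x * (r * ?q x - m)) = 2 * C / (A + C * x)"
      by simp
    then have "2 * (- (\<alpha> * k * m)) * (A + C * x) = 2 * C * (?q x * (r * ?q x - m))"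
      using nz[OF x'] affine_nz[OF x'] by (subst (asm) frac_eq_eq) auto
    then show ?thesis by (simp add: mult.assoc)
  qed
  let ?R = "\<lambda>x. C * ?q x * (r * ?q x - m)" and ?L = "\<lambda>x. - (\<alpha> * k * m) * (A + C * x)"
  have at_points: "?L (1/2) = ?R (1/2)" "?L (-1/2) = ?R (-1/2)" "?L 0 = ?R 0"
    by (rule poly, simp)+
  \<comment> \<open>The second difference annihilates the affine left-hand side and isolates the quadratic
    coefficient of the right-hand side.\<close>
  have "C * r * k\<^sup>2 = 2 * (?R (1/2) + ?R (-1/2) - 2 * ?R 0)"
    by (simp add: power2_eq_square field_simps)
  also have "\<dots> = 2 * (?L (1/2) + ?L (-1/2) - 2 * ?L 0)"
    by (simp only: at_points)
  also have "\<dots> = 0" by (simp add: field_simps)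
  finally have "C * r * k\<^sup>2 = 0" .
  \<comment> \<open>For \<open>k = 0\<close> the left-hand side is zero, and neither factor next to \<open>C\<close> vanishes.\<close>
  then show "C = 0"
    using r poly[of 0] nz[of 0] by auto
qed

section \<open>Gauss curvature from first derivatives\<close>

lemma inner_derivative_swap_of_orthogonal:
  fixes f g :: "real \<Rightarrow> 'a::real_inner"
  assumes S: "at s within S \<noteq> bot"
    and "s \<in> S"
    and f: "(f has_vector_derivative f') (at s within S)"
    and g: "(g has_vector_derivative g') (at s within S)"
    and z: "\<And>u. u \<in> S \<Longrightarrow> f u \<bullet> g u = 0"
  shows "f' \<bullet> g s = - (f s \<bullet> g')"
proof -
  have "((\<lambda>u. f u \<bullet> g u) has_vector_derivative f s \<bullet> g' + f' \<bullet> g s) (at s within S)"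
    by (rule bounded_bilinear.has_vector_derivative[OF bounded_bilinear_inner f g])
  moreover have "((\<lambda>u. f u \<bullet> g u) has_vector_derivative 0) (at s within S)"
    by (rule has_vector_derivative_transform[OF \<open>s \<in> S\<close> _ has_vector_derivative_const[of 0]])
      (simp add: z)
  ultimately have "f s \<bullet> g' + f' \<bullet> g s = 0"
    using vector_derivative_unique_within[OF S] by blast
  then show ?thesis by simp
qed

text \<open>
  The tangent vectors stay orthogonal to \<open>U\<close>, so a derivative can be moved from them to \<open>U\<close>, as in
  \<open>\<langle>X\<^sub>s\<^sub>s,U\<rangle> = - \<langle>X\<^sub>s,U\<^sub>s\<rangle>\<close>.  This expresses the second fundamental form by first
  derivatives of \<open>X\<close> and \<open>U\<close>.
\<close>
lemma gauss_curvature_weingarten: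
  fixes X U Xs Xt :: "real \<Rightarrow> real \<Rightarrow> real^3"
  assumes S: "\<And>u. u \<in> S \<Longrightarrow> at u within S \<noteq> bot" and s: "s \<in> S"
    and Xs: "\<And>u t. u \<in> S \<Longrightarrow> ((\<lambda>u. X u t) has_vector_derivative Xs u t) (at u within S)"
    and Xt: "\<And>t. ((\<lambda>t. X s t) has_vector_derivative Xt s t) (at t)"
    and Us: "((\<lambda>u. U u \<theta>) has_vector_derivative Us) (at s within S)"
    and Ut: "((\<lambda>t. U s t) has_vector_derivative Ut) (at \<theta>)"
    and Xss: "((\<lambda>u. Xs u \<theta>) has_vector_derivative Xss) (at s within S)"
    and Xst: "((\<lambda>t. Xs s t) has_vector_derivative Xst) (at \<theta>)"
    and Xtt: "((\<lambda>t. Xt s t) has_vector_derivative Xtt) (at \<theta>)"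
    and Xs_U: "\<And>u t. u \<in> S \<Longrightarrow> Xs u t \<bullet> U u t = 0"
    and Xt_U: "\<And>t. Xt s t \<bullet> U s t = 0"
  shows "gauss_curvature S X U s \<theta> =
    ((Xs s \<theta> \<bullet> Us) * (Xt s \<theta> \<bullet> Ut) - (Xs s \<theta> \<bullet> Ut)\<^sup>2) /
    ((Xs s \<theta> \<bullet> Xs s \<theta>) * (Xt s \<theta> \<bullet> Xt s \<theta>) - (Xs s \<theta> \<bullet> Xt s \<theta>)\<^sup>2)"
proof -
  have ps: "partial_s S X u t = Xs u t" if "u \<in> S" for u t
    unfolding partial_s_def using vector_derivative_within[OF S[OF that] Xs[OF that]] .
  have pt: "partial_t X s t = Xt s t" for t
    unfolding partial_t_def using Xt by (rule vector_derivative_at)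
  have "((\<lambda>u. partial_s S X u \<theta>) has_vector_derivative Xss) (at s within S)"
    by (rule has_vector_derivative_transform[OF s _ Xss]) (simp add: ps)
  then have pss: "partial_s S (partial_s S X) s \<theta> = Xss"
    unfolding partial_s_def[of S "partial_s S X"] using vector_derivative_within[OF S[OF s]] by blast
  have pst: "partial_t (partial_s S X) s \<theta> = Xst"
    unfolding partial_t_def[of "partial_s S X"] ps[OF s] using Xst by (rule vector_derivative_at)
  have ptt: "partial_t (partial_t X) s \<theta> = Xtt"
    unfolding partial_t_def[of "partial_t X"] pt using Xtt by (rule vector_derivative_at)
  have "Xss \<bullet> U s \<theta> = - (Xs s \<theta> \<bullet> Us)"
    by (rule inner_derivative_swap_of_orthogonal[OF S[OF s] s Xss Us]) (rule Xs_U)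
  moreover have "Xst \<bullet> U s \<theta> = - (Xs s \<theta> \<bullet> Ut)"
    by (rule inner_derivative_swap_of_orthogonal[OF _ _ Xst Ut]) (simp_all add: Xs_U[OF s])
  moreover have "Xtt \<bullet> U s \<theta> = - (Xt s \<theta> \<bullet> Ut)"
    by (rule inner_derivative_swap_of_orthogonal[OF _ _ Xtt Ut]) (simp_all add: Xt_U)
  ultimately show ?thesis
    by (simp add: gauss_curvature_def Let_def ps[OF s] pt pss pst ptt)
qed

section \<open>Curvature of canal surfaces\<close>

lemma smooth_within_real_derivative:
  fixes f :: "real \<Rightarrow> real"
  assumes "smooth_within S f"
  shows "\<exists>f'. smooth_within S f' \<and> (\<forall>u\<in>S. (f has_real_derivative f' u) (at u within S))"
proof -
  obtain D :: "nat \<Rightarrow> real \<Rightarrow> real" where D: "\<And>u. u \<in> S \<Longrightarrow> D 0 u = f u"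
    "\<And>n u. u \<in> S \<Longrightarrow> (D n has_vector_derivative D (Suc n) u) (at u within S)"
    using assms unfolding smooth_within_def by blast
  have "smooth_within S (D 1)"
    unfolding smooth_within_def by (rule exI[of _ "\<lambda>n. D (Suc n)"]) (simp add: D(2))
  moreover have "(f has_real_derivative D 1 u) (at u within S)" if "u \<in> S" for u
    unfolding has_real_derivative_iff_has_vector_derivative
  proof (rule has_vector_derivative_transform[OF that])
    show "(D 0 has_vector_derivative D 1 u) (at u within S)" using D(2)[OF that, of 0] by simp
  qed (simp add: D(1))
  ultimately show ?thesis by blast
qed

lemma canal_frame_orthonormal:
  assumes "canal_surface l c T N B \<kappa> \<tau> r \<phi>" "u \<in> {0..l}"
  shows "T u \<bullet> T u = 1" "N u \<bullet> N u = 1" "B u \<bullet> B u = 1"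
    "T u \<bullet> N u = 0" "T u \<bullet> B u = 0" "N u \<bullet> B u = 0"
proof -
  have TN: "norm (T u) = 1" "norm (N u) = 1" "T u \<bullet> N u = 0" "B u = cross3 (T u) (N u)"
    using assms unfolding canal_surface_def frenet_curve_def by auto
  then show "T u \<bullet> T u = 1" "N u \<bullet> N u = 1" "T u \<bullet> N u = 0"
    by (simp_all add: norm_eq_1)
  show "T u \<bullet> B u = 0" "N u \<bullet> B u = 0" using TN(4) by (simp_all add: dot_cross_self)
  show "B u \<bullet> B u = 1"
    using norm_cross[of "T u" "N u"] TN by (simp add: power2_norm_eq_inner)
qed

text \<open>
  Here \<open>p\<close> is \<open>\<phi>'(s)\<close>.  The quotient is the one of the two determinants, with no common factor
  cancelled.  Thus it is valid also at singular points, where both sides are \<open>0\<close> by the convention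
  for division by zero, and a nonzero value forces each factor to be nonzero.

  The map is \<open>X = c + r U\<close> with \<open>r' = - cos \<phi>\<close>, so \<open>X\<^sub>s = T - cos \<phi> U + r U\<^sub>s\<close> and
  \<open>X\<^sub>\<theta> = r U\<^sub>\<theta>\<close>.  With \<open>q = p + \<kappa> cos \<theta>\<close>, both fundamental forms are therefore
  determined by \<open>\<langle>T,U\<rangle> = cos \<phi>\<close>, \<open>\<langle>T,U\<^sub>s\<rangle> = - q sin \<phi>\<close>,
  \<open>\<langle>T,U\<^sub>\<theta>\<rangle> = 0\<close> and the Gram matrix of \<open>U\<^sub>s\<close>, \<open>U\<^sub>\<theta>\<close>.  Of the latter only the
  determinant \<open>q\<^sup>2 sin\<^sup>2 \<phi>\<close> and \<open>\<langle>U\<^sub>\<theta>,U\<^sub>\<theta>\<rangle> = sin\<^sup>2 \<phi>\<close> enter, and the torsion cancels from both.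
\<close>
lemma gauss_curvature_canal:
  assumes canal: "canal_surface l c T N B \<kappa> \<tau> r \<phi>"
    and s: "s \<in> {0..l}"
  obtains p where "\<And>\<theta>. gauss_curvature {0..l} (canal_map c T N B r \<phi>) (canal_normal T N B \<phi>) s \<theta> =
      (r s * (p + \<kappa> s * cos \<theta>) * (r s * (p + \<kappa> s * cos \<theta>) - sin (\<phi> s)) * (sin (\<phi> s))\<^sup>2) /
      ((r s)\<^sup>2 * (r s * (p + \<kappa> s * cos \<theta>) - sin (\<phi> s))\<^sup>2 * (sin (\<phi> s))\<^sup>2)"
proof -
  let ?S = "{0..l}"
  have l: "l > 0" using canal by (simp add: canal_surface_def)
  have S: "at u within ?S \<noteq> bot" if "u \<in> ?S" for u
    using that l by (simp add: trivial_limit_within islimpt_Icc)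
  have smooth: "smooth_within ?S \<kappa>" "smooth_within ?S \<tau>" "smooth_within ?S \<phi>"
    using canal unfolding canal_surface_def frenet_curve_def by auto
  obtain p where p: "smooth_within ?S p"
    and d\<phi>: "\<And>u. u \<in> ?S \<Longrightarrow> (\<phi> has_real_derivative p u) (at u within ?S)"
    using smooth_within_real_derivative[OF smooth(3)] by blast
  obtain p' where dp: "\<And>u. u \<in> ?S \<Longrightarrow> (p has_real_derivative p' u) (at u within ?S)"
    using smooth_within_real_derivative[OF p] by blast
  obtain \<kappa>' where d\<kappa>: "\<And>u. u \<in> ?S \<Longrightarrow> (\<kappa> has_real_derivative \<kappa>' u) (at u within ?S)"
    using smooth_within_real_derivative[OF smooth(1)] by blast
  obtain \<tau>' where d\<tau>: "\<And>u. u \<in> ?S \<Longrightarrow> (\<tau> has_real_derivative \<tau>' u) (at u within ?S)"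
    using smooth_within_real_derivative[OF smooth(2)] by blast
  have frame: "(c has_vector_derivative T u) (at u within ?S)"
    "(T has_vector_derivative \<kappa> u *\<^sub>R N u) (at u within ?S)"
    "(N has_vector_derivative - \<kappa> u *\<^sub>R T u + \<tau> u *\<^sub>R B u) (at u within ?S)"
    "(B has_vector_derivative - \<tau> u *\<^sub>R N u) (at u within ?S)"
    "(r has_real_derivative - cos (\<phi> u)) (at u within ?S)"
    if "u \<in> ?S" for u
    using canal that unfolding canal_surface_def frenet_curve_def by blast+
  have orth: "T u \<bullet> T u = 1" "N u \<bullet> N u = 1" "B u \<bullet> B u = 1"
    "T u \<bullet> N u = 0" "N u \<bullet> T u = 0" "T u \<bullet> B u = 0" "B u \<bullet> T u = 0" "N u \<bullet> B u = 0" "B u \<bullet> N u = 0"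
    if "u \<in> ?S" for u
    using canal_frame_orthonormal[OF canal that] by (auto simp: inner_commute)
  define U where "U = canal_normal T N B \<phi>"
  define Us where "Us u \<theta> = (- sin (\<phi> u) * (p u + \<kappa> u * cos \<theta>)) *\<^sub>R T u
    + (p u * cos (\<phi> u) * cos \<theta> + \<kappa> u * cos (\<phi> u) - \<tau> u * sin (\<phi> u) * sin \<theta>) *\<^sub>R N u
    + (p u * cos (\<phi> u) * sin \<theta> + \<tau> u * sin (\<phi> u) * cos \<theta>) *\<^sub>R B u" for u \<theta>
  define Ut where "Ut u \<theta> = (- sin (\<phi> u) * sin \<theta>) *\<^sub>R N u + (sin (\<phi> u) * cos \<theta>) *\<^sub>R B u" for u \<theta>
  define Xs where "Xs u \<theta> = T u - cos (\<phi> u) *\<^sub>R U u \<theta> + r u *\<^sub>R Us u \<theta>" for u \<theta>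
  define Xt where "Xt u \<theta> = r u *\<^sub>R Ut u \<theta>" for u \<theta>
  note UX = U_def canal_normal_def Us_def Ut_def
  have X: "canal_map c T N B r \<phi> u \<theta> = c u + r u *\<^sub>R U u \<theta>" for u \<theta>
    by (simp add: canal_map_def U_def canal_normal_def algebra_simps)
  have dUs: "((\<lambda>u. U u \<theta>) has_vector_derivative Us u \<theta>) (at u within ?S)" if "u \<in> ?S" for u \<theta>
    unfolding U_def canal_normal_def Us_def
    by (rule derivative_eq_intros frame d\<phi> that refl)+
      (simp add: algebra_simps)
  have dUt: "((\<lambda>t. U s t) has_vector_derivative Ut s t) (at t)" for t
    unfolding U_def canal_normal_def Ut_def
    by (rule derivative_eq_intros refl)+ (simp add: algebra_simps)
  have dUtt: "\<exists>V. ((\<lambda>t. Ut s t) has_vector_derivative V) (at t)" for t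
    unfolding Ut_def
    by (rule exI) (rule derivative_eq_intros refl)+
  have dUss: "\<exists>V. ((\<lambda>u. Us u \<theta>) has_vector_derivative V) (at s within ?S)" for \<theta>
    unfolding Us_def
    by (rule exI) (rule derivative_eq_intros frame d\<phi> d\<kappa> d\<tau> dp s refl)+
  have dUst: "\<exists>V. ((\<lambda>t. Us s t) has_vector_derivative V) (at t)" for t
    unfolding Us_def
    by (rule exI) (rule derivative_eq_intros refl)+
  have dXs: "((\<lambda>u. canal_map c T N B r \<phi> u \<theta>) has_vector_derivative Xs u \<theta>) (at u within ?S)"
    if "u \<in> ?S" for u \<theta>
    unfolding X Xs_def
    by (rule derivative_eq_intros frame dUs that refl)+ (simp add: algebra_simps)
  have dXt: "((\<lambda>t. canal_map c T N B r \<phi> s t) has_vector_derivative Xt s t) (at t)" for t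
    unfolding X Xt_def
    by (rule derivative_eq_intros dUt refl)+ (simp add: algebra_simps)
  have dXss: "\<exists>V. ((\<lambda>u. Xs u \<theta>) has_vector_derivative V) (at s within ?S)" for \<theta>
  proof -
    obtain V where "((\<lambda>u. Us u \<theta>) has_vector_derivative V) (at s within ?S)" using dUss by blast
    then show ?thesis unfolding Xs_def
      by - (rule exI, (rule derivative_eq_intros frame d\<phi> dUs s refl | assumption)+)
  qed
  have dXst: "\<exists>V. ((\<lambda>t. Xs s t) has_vector_derivative V) (at t)" for t
  proof -
    obtain V where "((\<lambda>t. Us s t) has_vector_derivative V) (at t)" using dUst by blast
    then show ?thesis unfolding Xs_def
      by - (rule exI, (rule derivative_eq_intros dUt refl | assumption)+)
  qed
  have dXtt: "\<exists>V. ((\<lambda>t. Xt s t) has_vector_derivative V) (at t)" for t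
  proof -
    obtain V where "((\<lambda>t. Ut s t) has_vector_derivative V) (at t)" using dUtt by blast
    then show ?thesis unfolding Xt_def
      by - (rule exI, (rule derivative_eq_intros refl | assumption)+)
  qed
  have trig: "(sin x)\<^sup>2 + (cos x)\<^sup>2 = 1" for x :: real by simp
  have U_U: "U u \<theta> \<bullet> U u \<theta> = 1" "U u \<theta> \<bullet> Us u \<theta> = 0" "U u \<theta> \<bullet> Ut u \<theta> = 0"
      "U u \<theta> \<bullet> T u = cos (\<phi> u)" if "u \<in> ?S" for u \<theta>
    using trig[of "\<phi> u"] trig[of \<theta>] unfolding UX
    by (simp_all add: inner_simps orth[OF that]; algebra)+
  have T_U: "T s \<bullet> Us s \<theta> = - sin (\<phi> s) * (p s + \<kappa> s * cos \<theta>)" "T s \<bullet> Ut s \<theta> = 0" for \<theta>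
    unfolding UX by (simp_all add: inner_simps orth[OF s])
  have Ut_Ut: "Ut s \<theta> \<bullet> Ut s \<theta> = (sin (\<phi> s))\<^sup>2" for \<theta>
    using trig[of \<theta>] unfolding UX by (simp add: inner_simps orth[OF s]; algebra)
  have gram: "(Us s \<theta> \<bullet> Us s \<theta>) * (Ut s \<theta> \<bullet> Ut s \<theta>) - (Us s \<theta> \<bullet> Ut s \<theta>)\<^sup>2
      = (p s + \<kappa> s * cos \<theta>)\<^sup>2 * (sin (\<phi> s))\<^sup>2" for \<theta>
    using trig[of "\<phi> s"] trig[of \<theta>] unfolding UX by (simp add: inner_simps orth[OF s]; algebra)
  have "gauss_curvature ?S (canal_map c T N B r \<phi>) U s \<theta> =
      (r s * (p s + \<kappa> s * cos \<theta>) * (r s * (p s + \<kappa> s * cos \<theta>) - sin (\<phi> s)) * (sin (\<phi> s))\<^sup>2) /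
      ((r s)\<^sup>2 * (r s * (p s + \<kappa> s * cos \<theta>) - sin (\<phi> s))\<^sup>2 * (sin (\<phi> s))\<^sup>2)" for \<theta>
  proof -
    obtain Xss Xst Xtt where
      "((\<lambda>u. Xs u \<theta>) has_vector_derivative Xss) (at s within ?S)"
      "((\<lambda>t. Xs s t) has_vector_derivative Xst) (at \<theta>)"
      "((\<lambda>t. Xt s t) has_vector_derivative Xtt) (at \<theta>)"
      using dXss dXst dXtt by metis
    note W = gauss_curvature_weingarten[where U = U and Xs = Xs and Xt = Xt and \<theta> = \<theta>,
        OF S s dXs dXt dUs[OF s] dUt this]
    have Xs_U: "Xs u t \<bullet> U u t = 0" if "u \<in> ?S" for u t
      using U_U[OF that, of t] by (simp add: Xs_def inner_simps inner_commute)
    have Xt_U: "Xt s t \<bullet> U s t = 0" for t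
      using U_U[OF s, of t] by (simp add: Xt_def inner_simps inner_commute)
    have K: "gauss_curvature ?S (canal_map c T N B r \<phi>) U s \<theta> =
        ((Xs s \<theta> \<bullet> Us s \<theta>) * (Xt s \<theta> \<bullet> Ut s \<theta>) - (Xs s \<theta> \<bullet> Ut s \<theta>)\<^sup>2) /
        ((Xs s \<theta> \<bullet> Xs s \<theta>) * (Xt s \<theta> \<bullet> Xt s \<theta>) - (Xs s \<theta> \<bullet> Xt s \<theta>)\<^sup>2)"
      by (rule W) (simp_all add: Xs_U Xt_U)
    \<comment> \<open>The remaining computation is polynomial in the entries of the Gram matrix of \<open>U\<^sub>s\<close>,
      \<open>U\<^sub>\<theta>\<close>; keeping them opaque keeps it small.\<close>
    define e f g q where "e = Us s \<theta> \<bullet> Us s \<theta>" and "f = Us s \<theta> \<bullet> Ut s \<theta>"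
      and "g = Ut s \<theta> \<bullet> Ut s \<theta>" and "q = p s + \<kappa> s * cos \<theta>"
    note efg = e_def[symmetric] f_def[symmetric] g_def[symmetric] q_def[symmetric]
    have g: "g = (sin (\<phi> s))\<^sup>2" using Ut_Ut by (simp add: g_def)
    have eg: "e * g - f\<^sup>2 = q\<^sup>2 * (sin (\<phi> s))\<^sup>2" using gram by (simp add: e_def f_def g_def q_def)
    have inners: "U s \<theta> \<bullet> U s \<theta> = 1" "U s \<theta> \<bullet> Us s \<theta> = 0" "Us s \<theta> \<bullet> U s \<theta> = 0"
        "U s \<theta> \<bullet> Ut s \<theta> = 0" "U s \<theta> \<bullet> T s = cos (\<phi> s)" "T s \<bullet> U s \<theta> = cos (\<phi> s)"
        "T s \<bullet> Us s \<theta> = - sin (\<phi> s) * q" "Us s \<theta> \<bullet> T s = - sin (\<phi> s) * q" "T s \<bullet> Ut s \<theta> = 0"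
        "T s \<bullet> T s = 1"
      using U_U[OF s, of \<theta>] T_U[of \<theta>] orth[OF s] by (auto simp: inner_commute q_def)
    have X_inners: "Xs s \<theta> \<bullet> Us s \<theta> = - sin (\<phi> s) * q + r s * e" "Xs s \<theta> \<bullet> Ut s \<theta> = r s * f"
        "Xt s \<theta> \<bullet> Ut s \<theta> = r s * g" "Xs s \<theta> \<bullet> Xt s \<theta> = (r s)\<^sup>2 * f" "Xt s \<theta> \<bullet> Xt s \<theta> = (r s)\<^sup>2 * g"
      by (simp_all add: Xs_def Xt_def inner_simps inners efg power2_eq_square)
    have Xs_Xs: "Xs s \<theta> \<bullet> Xs s \<theta> = (sin (\<phi> s))\<^sup>2 - 2 * r s * sin (\<phi> s) * q + (r s)\<^sup>2 * e"
      using trig[of "\<phi> s"] by (simp add: Xs_def inner_simps inners efg; algebra)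
    have num: "(Xs s \<theta> \<bullet> Us s \<theta>) * (Xt s \<theta> \<bullet> Ut s \<theta>) - (Xs s \<theta> \<bullet> Ut s \<theta>)\<^sup>2
        = r s * q * (r s * q - sin (\<phi> s)) * (sin (\<phi> s))\<^sup>2"
      unfolding X_inners using g eg by algebra
    have den: "(Xs s \<theta> \<bullet> Xs s \<theta>) * (Xt s \<theta> \<bullet> Xt s \<theta>) - (Xs s \<theta> \<bullet> Xt s \<theta>)\<^sup>2
        = (r s)\<^sup>2 * (r s * q - sin (\<phi> s))\<^sup>2 * (sin (\<phi> s))\<^sup>2"
      unfolding X_inners Xs_Xs using g eg by algebra
    show ?thesis unfolding K num den q_def ..
  qed
  then show ?thesis using that unfolding U_def by blast
qed

section \<open>Direction of the spine curve of a translator\<close>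

theorem proposition1:
  fixes \<alpha> l :: real
    and w :: "real^3"
    and c T N B :: "real \<Rightarrow> real^3"
    and \<kappa> \<tau> r \<phi> :: "real \<Rightarrow> real"
  assumes "\<alpha> \<noteq> 0"
    and "canal_surface l c T N B \<kappa> \<tau> r \<phi>"
    and "K_translator \<alpha> w {0..l} {0..<2 * pi} (canal_map c T N B r \<phi>) (canal_normal T N B \<phi>)"
  shows "\<forall>s\<in>{0..l}. \<exists>k. T s = k *\<^sub>R w"
proof
  fix s assume s: "s \<in> {0..l}"
  have r: "r s \<noteq> 0" using assms(2) s unfolding canal_surface_def by force
  define G where "G \<theta> = gauss_curvature {0..l} (canal_map c T N B r \<phi>) (canal_normal T N B \<phi>) s \<theta>" for \<theta>
  obtain p where K: "\<And>\<theta>. G \<theta> =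
      (r s * (p + \<kappa> s * cos \<theta>) * (r s * (p + \<kappa> s * cos \<theta>) - sin (\<phi> s)) * (sin (\<phi> s))\<^sup>2) /
      ((r s)\<^sup>2 * (r s * (p + \<kappa> s * cos \<theta>) - sin (\<phi> s))\<^sup>2 * (sin (\<phi> s))\<^sup>2)"
    using gauss_curvature_canal[OF assms(2) s] unfolding G_def by blast
  have tr: "G \<theta> \<noteq> 0" "real_power_defined (G \<theta>) \<alpha>"
      "real_power (G \<theta>) \<alpha> = canal_normal T N B \<phi> s \<theta> \<bullet> w" if "\<theta> \<in> {0..<2 * pi}" for \<theta>
    using assms(3) s that unfolding K_translator_def G_def by auto
  \<comment> \<open>The formula for \<open>G\<close> keeps the common factors of numerator and denominator, so \<open>G \<theta> \<noteq> 0\<close>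
    yields \<open>sin \<phi> \<noteq> 0\<close> as well.\<close>
  have nz: "p + \<kappa> s * cos \<theta> \<noteq> 0" "r s * (p + \<kappa> s * cos \<theta>) - sin (\<phi> s) \<noteq> 0" "sin (\<phi> s) \<noteq> 0"
    if "\<theta> \<in> {0..<2 * pi}" for \<theta>
    using tr(1)[OF that, unfolded K divide_eq_0_iff mult_eq_0_iff] by auto
  have Gq: "G \<theta> = (p + \<kappa> s * cos \<theta>) / (r s * (r s * (p + \<kappa> s * cos \<theta>) - sin (\<phi> s)))"
    if "\<theta> \<in> {0..<2 * pi}" for \<theta>
    unfolding K using nz[OF that] r by (simp add: power2_eq_square)
  have sin_nz: "sin (\<phi> s) \<noteq> 0" using nz(3)[of 0] by simp
  have normal: "canal_normal T N B \<phi> s \<theta> \<bullet> w = cos (\<phi> s) * (T s \<bullet> w)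
      + (sin (\<phi> s) * (N s \<bullet> w)) * cos \<theta> + (sin (\<phi> s) * (B s \<bullet> w)) * sin \<theta>" for \<theta>
    by (simp add: canal_normal_def inner_simps)
  have B: "B s \<bullet> w = 0"
  proof -
    have cs: "cos (3 * pi / 2) = 0" "sin (3 * pi / 2) = - 1"
      using cos_3over2_pi sin_3over2_pi by simp_all
    have "G (pi / 2) = G (3 * pi / 2)" by (simp add: K cs)
    moreover have "pi / 2 \<in> {0..<2 * pi}" "3 * pi / 2 \<in> {0..<2 * pi}" by auto
    ultimately have "canal_normal T N B \<phi> s (pi / 2) \<bullet> w = canal_normal T N B \<phi> s (3 * pi / 2) \<bullet> w"
      using tr(3) by metis
    then show ?thesis using sin_nz by (simp add: normal cs)
  qed
  have arc: "arccos x \<in> {0..<2 * pi}" "cos (arccos x) = x" if "x \<in> {-1..1}" for x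
    using arccos_lbound[of x] arccos_ubound[of x] that by (auto intro: le_less_trans[of _ pi])
  have "sin (\<phi> s) * (N s \<bullet> w) = 0"
  proof (rule affine_power_of_moebius_constant[OF r])
    fix x :: real assume x: "x \<in> {-1..1}"
    note a = arc[OF x]
    show "p + \<kappa> s * x \<noteq> 0" using nz(1)[OF a(1)] a(2) by simp
    show "r s * (p + \<kappa> s * x) - sin (\<phi> s) \<noteq> 0" using nz(2)[OF a(1)] a(2) by simp
    show "real_power_defined ((p + \<kappa> s * x) / (r s * (r s * (p + \<kappa> s * x) - sin (\<phi> s)))) \<alpha>"
      using tr(2)[OF a(1)] Gq[OF a(1)] a(2) by simp
    show "real_power ((p + \<kappa> s * x) / (r s * (r s * (p + \<kappa> s * x) - sin (\<phi> s)))) \<alpha>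
        = cos (\<phi> s) * (T s \<bullet> w) + (sin (\<phi> s) * (N s \<bullet> w)) * x"
      using tr(3)[OF a(1)] Gq[OF a(1)] a(2) by (simp add: normal B)
  qed
  then have N: "N s \<bullet> w = 0" using sin_nz by simp
  have w: "w \<bullet> w = 1" using assms(3) by (simp add: K_translator_def norm_eq_1)
  note frame = canal_frame_orthonormal[OF assms(2) s]
  show "\<exists>k. T s = k *\<^sub>R w"
  proof
    \<comment> \<open>As \<open>B = T \<times> N\<close>, the vector \<open>w \<times> B\<close> is \<open>- \<langle>T,w\<rangle> N\<close>, and it has length \<open>1\<close> because \<open>w\<close> and
      \<open>B\<close> are orthogonal unit vectors.  So \<open>\<langle>T,w\<rangle>\<^sup>2 = 1\<close>, the equality case of Cauchy-Schwarz.\<close>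
    have "cross3 w (B s) = - (T s \<bullet> w) *\<^sub>R N s"
      using assms(2) s N unfolding canal_surface_def frenet_curve_def
      by (simp add: Lagrange inner_commute)
    then have "(norm (cross3 w (B s)))\<^sup>2 = (T s \<bullet> w)\<^sup>2"
      using frame(2) by (simp add: norm_eq_1[symmetric])
    moreover have "(norm (cross3 w (B s)))\<^sup>2 = 1"
      using norm_cross[of w "B s"] w frame(3) B
      by (simp add: power2_norm_eq_inner inner_commute)
    ultimately have "(T s \<bullet> w)\<^sup>2 = 1" by simp
    then have "(T s - (T s \<bullet> w) *\<^sub>R w) \<bullet> (T s - (T s \<bullet> w) *\<^sub>R w) = 0"
      using w frame(1) by (simp add: inner_simps inner_commute power2_eq_square)
    then show "T s = (T s \<bullet> w) *\<^sub>R w" by simp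
  qed
qed

end
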